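(* Let $n=3$, let $A_1A_2A_3$ be a triangle in $\mathbb{R}^2$ with closed convex curves $\gamma_1,\gamma_2,\gamma_3$ around its vertices and associated curvilinear hexagon $\Omega$ as described in the context, and let $w_1,w_2,w_3>0$. Let $P$ be the generalized Fermat-Torricelli point, i.e. the minimizer of $\sum_{i=1}^3 w_i\,d(P,\gamma_i)$. If $P$ is an interior point of $\Omega$, then $$\cos\varphi_1=\frac{w_1^2-w_2^2-w_3^2}{2w_2w_3},\qquad \cos\varphi_2=\frac{w_2^2-w_1^2-w_3^2}{2w_1w_3},\qquad \cos\varphi_3=\frac{w_3^2-w_1^2-w_2^2}{2w_1w_2},$$ where, with $A_i'$ the projection of $P$ onto $\gamma_i$, $\varphi_i$ is the angle at $P$ between the segments $A_j'P$ and $A_k'P$, $\{i,j,k\}=\{1,2,3\}$.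
   Context: Setting: $A_1A_2A_3$ is a triangle in $\mathbb{R}^2$. For each $i$, $\gamma_i$ is a closed convex curve surrounding $A_i$ that meets orthogonally the two sides of the triangle containing $A_i$; the curves $\gamma_i$ do not intersect each other inside the triangle. Segments on the edges of the triangle and three arcs of the curves $\gamma_i$ bound a curvilinear hexagon $\Omega$. $d(P,\gamma_i)$ denotes the Euclidean distance from $P$ to $\gamma_i$. For $P\in\Omega$, $A_i'=\pi_i(P)$ is the (nearest-point) projection of $P$ onto $\gamma_i$; the segment $PA_i'$ meets $\gamma_i$ orthogonally. *)

theory Defs
  imports "HOL-Analysis.Analysis"
begin

text \<open>Triples are indexed by the three-element type \<open>3\<close>, whose elements are \<open>1\<close>, \<open>2\<close> and
  \<open>3\<close> (with \<open>3 = 0\<close>).\<close>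

definition closed_convex_curve :: "(real \<Rightarrow> real ^ 2) \<Rightarrow> bool" where
  "closed_convex_curve g \<longleftrightarrow>
     simple_path g \<and> pathfinish g = pathstart g \<and>
     (\<exists>K. compact K \<and> convex K \<and> path_image g = frontier K)"

text \<open>The secant directions of \<open>\<Gamma>\<close> at \<open>Q\<close> become perpendicular to \<open>v\<close>. If \<open>\<Gamma>\<close> is a simple
  closed curve and \<open>v \<noteq> 0\<close>, this says that \<open>\<Gamma>\<close> has a tangent line at \<open>Q\<close> and that \<open>v\<close> is
  normal to it; no differentiable parametrization is needed, and nothing is required of \<open>\<Gamma>\<close> away
  from \<open>Q\<close>.\<close>

definition normal_at :: "(real ^ 2) set \<Rightarrow> real ^ 2 \<Rightarrow> real ^ 2 \<Rightarrow> bool" where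
  "normal_at \<Gamma> Q v \<longleftrightarrow> ((\<lambda>X. (v \<bullet> (X - Q)) / norm (X - Q)) \<longlongrightarrow> 0) (at Q within \<Gamma>)"

definition meets_orthogonally :: "(real ^ 2) set \<Rightarrow> real ^ 2 \<Rightarrow> real ^ 2 \<Rightarrow> bool" where
  "meets_orthogonally \<Gamma> a b \<longleftrightarrow>
     \<Gamma> \<inter> closed_segment a b \<noteq> {} \<and>
     (\<forall>Q \<in> \<Gamma> \<inter> closed_segment a b. normal_at \<Gamma> Q (b - a))"

text \<open>The last condition keeps each curve away from the side opposite to its vertex. Without it a
  curve could bulge through that side, and the region cut out of the triangle would not be bounded
  by exactly three segments and three arcs.\<close>

definition hexagon_configuration :: "(3 \<Rightarrow> real ^ 2) \<Rightarrow> (3 \<Rightarrow> real \<Rightarrow> real ^ 2) \<Rightarrow> bool" where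
  "hexagon_configuration A \<gamma> \<longleftrightarrow>
     \<not> collinear {A 1, A 2, A 3} \<and>
     (\<forall>i. closed_convex_curve (\<gamma> i) \<and> A i \<in> inside (path_image (\<gamma> i))) \<and>
     (\<forall>i j. j \<noteq> i \<longrightarrow> meets_orthogonally (path_image (\<gamma> i)) (A i) (A j)) \<and>
     (\<forall>i j. i \<noteq> j \<longrightarrow>
        path_image (\<gamma> i) \<inter> path_image (\<gamma> j) \<inter> convex hull {A 1, A 2, A 3} = {}) \<and>
     (\<forall>i j k. i \<noteq> j \<and> i \<noteq> k \<and> j \<noteq> k \<longrightarrow>
        path_image (\<gamma> i) \<inter> closed_segment (A j) (A k) = {})"

text \<open>The closed region bounded by the three segments and the three arcs.\<close>

definition curvilinear_hexagon ::
  "(3 \<Rightarrow> real ^ 2) \<Rightarrow> (3 \<Rightarrow> real \<Rightarrow> real ^ 2) \<Rightarrow> (real ^ 2) set" where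
  "curvilinear_hexagon A \<gamma> =
     convex hull {A 1, A 2, A 3} - (\<Union>i. inside (path_image (\<gamma> i)))"

text \<open>The unoriented angle at \<open>P\<close> between the segments \<open>XP\<close> and \<open>YP\<close>, in \<open>[0, pi]\<close>. It is
  meaningful only if \<open>X \<noteq> P\<close> and \<open>Y \<noteq> P\<close>.\<close>

definition angle_at :: "real ^ 2 \<Rightarrow> real ^ 2 \<Rightarrow> real ^ 2 \<Rightarrow> real" where
  "angle_at X P Y = arccos (((X - P) \<bullet> (Y - P)) / (norm (X - P) * norm (Y - P)))"

end

theory Submission
  imports Defs
begin

text \<open>Each curve lies in the closure of its inside, so the interior point \<open>P\<close> lies on none of
  them. Also \<open>d(X, \<gamma>\<^sub>i) \<le> |X - A\<^sub>i'|\<close> for all \<open>X\<close>, with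
  equality at \<open>X = P\<close>. Hence \<open>P\<close> is also a local minimizer of \<open>\<Sum>\<^sub>i w\<^sub>i |X - A\<^sub>i'|\<close>, a function that
  is differentiable at \<open>P\<close>. Its gradient vanishes there, i.e. the unit vectors \<open>u\<^sub>i\<close> from \<open>P\<close>
  towards \<open>A\<^sub>i'\<close> satisfy \<open>\<Sum>\<^sub>i w\<^sub>i u\<^sub>i = 0\<close>. Isolating one term and taking squared norms gives the
  three cosines.\<close>

text \<open>For a bounded convex \<open>K\<close>, the inside of \<open>frontier K\<close> is
  \<open>interior K\<close>. Once this is nonempty, convexity makes its closure all of
  \<open>closure K\<close>, which contains the frontier.\<close>

lemma closed_convex_curve_subset_closure_inside:
  assumes "closed_convex_curve g" and "inside (path_image g) \<noteq> {}"
  shows "path_image g \<subseteq> closure (inside (path_image g))"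
proof -
  obtain K where K: "compact K" "convex K" "path_image g = frontier K"
    using assms(1) by (auto simp: closed_convex_curve_def)
  have ins: "inside (path_image g) = interior K"
    using K by (simp add: inside_frontier_eq_interior compact_imp_bounded)
  then have "closure (interior K) = closure K"
    using assms(2) K(2) by (simp add: convex_closure_interior)
  then show ?thesis
    using K(3) ins by (auto simp: frontier_def)
qed

text \<open>An open set that meets the closure of an inside meets the inside itself, which the
  hexagon excludes. This yields \<open>A' i \<noteq> P\<close>, needed both for differentiability at
  \<open>P\<close> and for unit directions.\<close>

lemma interior_hexagon_not_on_curve:
  assumes "hexagon_configuration A \<gamma>" and "P \<in> interior (curvilinear_hexagon A \<gamma>)"
  shows "P \<notin> path_image (\<gamma> i)"
proof
  assume "P \<in> path_image (\<gamma> i)"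
  moreover have "closed_convex_curve (\<gamma> i)" "inside (path_image (\<gamma> i)) \<noteq> {}"
    using assms(1) by (auto simp: hexagon_configuration_def)
  ultimately have "P \<in> closure (inside (path_image (\<gamma> i)))"
    using closed_convex_curve_subset_closure_inside by blast
  then have "interior (curvilinear_hexagon A \<gamma>) \<inter> inside (path_image (\<gamma> i)) \<noteq> {}"
    using assms(2) open_Int_closure_eq_empty[OF open_interior] by blast
  then show False
    using interior_subset by (fastforce simp: curvilinear_hexagon_def)
qed

lemma infdist_eq_dist_closest_point:
  assumes "closed S" and "S \<noteq> {}"
  shows "infdist x S = dist x (closest_point S x)"
  using assms setdist_closest_point[OF assms, of x] by (simp add: infdist_eq_setdist)

lemma weighted_dist_sum_min_imp_balanced:
  fixes a :: "'i \<Rightarrow> 'a::real_inner"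
  assumes min: "\<And>X. X \<in> S \<Longrightarrow> (\<Sum>i\<in>I. w i * dist P (a i)) \<le> (\<Sum>i\<in>I. w i * dist X (a i))"
    and int: "P \<in> interior S"
    and ne: "\<And>i. i \<in> I \<Longrightarrow> a i \<noteq> P"
  shows "(\<Sum>i\<in>I. w i *\<^sub>R sgn (a i - P)) = 0"
proof -
  let ?v = "\<Sum>i\<in>I. w i *\<^sub>R sgn (P - a i)"
  define f where "f = (\<lambda>X. \<Sum>i\<in>I. w i * norm (X - a i))"
  have "((\<lambda>X. norm (X - a i)) has_derivative (\<lambda>h. sgn (P - a i) \<bullet> h)) (at P)" if "i \<in> I" for i
  proof -
    have sub: "((\<lambda>X. X - a i) has_derivative (\<lambda>h. h)) (at P)"
      by (auto intro!: derivative_eq_intros)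
    show ?thesis
      using has_derivative_compose[OF sub has_derivative_norm] ne[OF that]
      by (auto simp: inner_commute)
  qed
  then have "(f has_derivative (\<lambda>h. \<Sum>i\<in>I. w i * (sgn (P - a i) \<bullet> h))) (at P)"
    unfolding f_def by (intro has_derivative_sum has_derivative_mult_right)
  moreover have "(\<lambda>h. \<Sum>i\<in>I. w i * (sgn (P - a i) \<bullet> h)) = (\<lambda>h. ?v \<bullet> h)"
    by (simp add: inner_sum_left)
  ultimately have der: "(f has_derivative (\<lambda>h. ?v \<bullet> h)) (at P)"
    by simp
  \<comment> \<open>Fermat's rule needs an open domain, so minimality is used on
    \<open>interior S\<close> only.\<close>
  have "(\<lambda>h. ?v \<bullet> h) = (\<lambda>h. 0)"
    using int min interior_subset[of S]
    by (intro differential_zero_maxmin[OF _ open_interior der]) (auto simp: f_def dist_norm)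
  \<comment> \<open>The vanishing differential is evaluated in the direction of the gradient
    \<open>?v\<close> itself.\<close>
  then have "?v \<bullet> ?v = 0"
    by (rule fun_cong)
  then have "?v = 0"
    by simp
  moreover have "(\<Sum>i\<in>I. w i *\<^sub>R sgn (a i - P)) = - ?v"
    by (subst sgn_minus[of "P - a _", simplified]) (simp add: sum_negf)
  ultimately show ?thesis
    by simp
qed

text \<open>Cauchy-Schwarz puts the argument of \<open>arccos\<close> into [-1, 1]. If
  \<open>X = P\<close> or \<open>Y = P\<close>, both sides are 0, since \<open>sgn 0 = 0\<close> and
  division by zero gives 0.\<close>

lemma cos_angle_at: "cos (angle_at X P Y) = sgn (X - P) \<bullet> sgn (Y - P)"
proof -
  have *: "((X - P) \<bullet> (Y - P)) / (norm (X - P) * norm (Y - P)) = sgn (X - P) \<bullet> sgn (Y - P)"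
    unfolding sgn_div_norm by (simp add: divide_inverse ac_simps)
  have "\<bar>sgn (X - P) \<bullet> sgn (Y - P)\<bar> \<le> norm (sgn (X - P)) * norm (sgn (Y - P))"
    by (rule Cauchy_Schwarz_ineq2)
  also have "\<dots> \<le> 1"
    by (simp add: norm_sgn)
  finally show ?thesis
    unfolding angle_at_def * by (intro cos_arccos) auto
qed

text \<open>This is the law of cosines for a closed triangle with side vectors
  \<open>a *\<^sub>R u\<close>, \<open>b *\<^sub>R v\<close>, \<open>c *\<^sub>R z\<close>. For
  positive coefficients the angle between \<open>v\<close> and \<open>z\<close> is an exterior
  angle, hence the sign opposite to the usual one.\<close>

lemma inner_of_unit_triple:
  fixes u v z :: "'a::real_inner"
  assumes "a *\<^sub>R u + b *\<^sub>R v + c *\<^sub>R z = 0"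
    and "norm u = 1" "norm v = 1" "norm z = 1" "b \<noteq> 0" "c \<noteq> 0"
  shows "v \<bullet> z = (a\<^sup>2 - b\<^sup>2 - c\<^sup>2) / (2 * b * c)"
proof -
  have unit: "u \<bullet> u = 1" "v \<bullet> v = 1" "z \<bullet> z = 1"
    using assms(2-4) by (simp_all add: dot_square_norm)
  have "b *\<^sub>R v + c *\<^sub>R z = - (a *\<^sub>R u)"
    using assms(1) by (simp add: eq_neg_iff_add_eq_0 ac_simps)
  then have "(b *\<^sub>R v + c *\<^sub>R z) \<bullet> (b *\<^sub>R v + c *\<^sub>R z) = (a *\<^sub>R u) \<bullet> (a *\<^sub>R u)"
    by simp
  then have "b\<^sup>2 + c\<^sup>2 + 2 * b * c * (v \<bullet> z) = a\<^sup>2"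
    using unit by (simp add: inner_add_left inner_add_right inner_commute power2_eq_square algebra_simps)
  then show ?thesis
    using assms(5,6) by (simp add: field_simps)
qed

theorem theorem2:
  fixes A A' :: "3 \<Rightarrow> real ^ 2"
    and \<gamma> :: "3 \<Rightarrow> real \<Rightarrow> real ^ 2"
    and w \<phi> :: "3 \<Rightarrow> real"
    and P :: "real ^ 2"
  assumes "hexagon_configuration A \<gamma>"
    and "\<And>i. w i > 0"
    and "is_arg_min (\<lambda>X. \<Sum>i\<in>UNIV. w i * infdist X (path_image (\<gamma> i)))
           (\<lambda>X. X \<in> curvilinear_hexagon A \<gamma>) P"
    and "P \<in> interior (curvilinear_hexagon A \<gamma>)"
    and "\<And>i. A' i = closest_point (path_image (\<gamma> i)) P"
    and "\<phi> 1 = angle_at (A' 2) P (A' 3)"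
    and "\<phi> 2 = angle_at (A' 1) P (A' 3)"
    and "\<phi> 3 = angle_at (A' 1) P (A' 2)"
  shows "cos (\<phi> 1) = ((w 1)\<^sup>2 - (w 2)\<^sup>2 - (w 3)\<^sup>2) / (2 * w 2 * w 3) \<and>
         cos (\<phi> 2) = ((w 2)\<^sup>2 - (w 1)\<^sup>2 - (w 3)\<^sup>2) / (2 * w 1 * w 3) \<and>
         cos (\<phi> 3) = ((w 3)\<^sup>2 - (w 1)\<^sup>2 - (w 2)\<^sup>2) / (2 * w 1 * w 2)"
proof -
  let ?S = "\<lambda>i. path_image (\<gamma> i)"
  have curve: "closed (?S i)" "?S i \<noteq> {}" for i
    using assms(1)
    by (auto simp: hexagon_configuration_def closed_convex_curve_def
        intro: closed_path_image simple_path_imp_path)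
  have dist_P: "infdist P (?S i) = dist P (A' i)" for i
    using infdist_eq_dist_closest_point[OF curve] assms(5) by simp
  have A'_in: "A' i \<in> ?S i" for i
    using closest_point_in_set[OF curve] assms(5) by simp
  have ne: "A' i \<noteq> P" for i
    using A'_in interior_hexagon_not_on_curve[OF assms(1,4)] by metis
  have "(\<Sum>i\<in>UNIV. w i * dist P (A' i)) \<le> (\<Sum>i\<in>UNIV. w i * dist X (A' i))"
    if X: "X \<in> curvilinear_hexagon A \<gamma>" for X
  proof -
    have "(\<Sum>i\<in>UNIV. w i * dist P (A' i)) \<le> (\<Sum>i\<in>UNIV. w i * infdist X (?S i))"
      using assms(3) X by (auto simp: is_arg_min_linorder dist_P)
    also have "\<dots> \<le> (\<Sum>i\<in>UNIV. w i * dist X (A' i))"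
      using assms(2) A'_in
      by (intro sum_mono mult_left_mono infdist_le) (auto simp: less_imp_le)
    finally show ?thesis .
  qed
  from weighted_dist_sum_min_imp_balanced[OF this assms(4) ne]
  have bal: "w 1 *\<^sub>R sgn (A' 1 - P) + w 2 *\<^sub>R sgn (A' 2 - P) + w 3 *\<^sub>R sgn (A' 3 - P) = 0"
    by (simp add: sum_3)
  \<comment> \<open>The term to be isolated comes first; the other two keep the order in which
    \<open>\<phi> 2\<close> and \<open>\<phi> 3\<close> list their points.\<close>
  then have bal2: "w 2 *\<^sub>R sgn (A' 2 - P) + w 1 *\<^sub>R sgn (A' 1 - P) + w 3 *\<^sub>R sgn (A' 3 - P) = 0"
    and bal3: "w 3 *\<^sub>R sgn (A' 3 - P) + w 1 *\<^sub>R sgn (A' 1 - P) + w 2 *\<^sub>R sgn (A' 2 - P) = 0"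
    by (simp_all add: ac_simps)
  have unit: "norm (sgn (A' i - P)) = 1" and w: "w i \<noteq> 0" for i
    using ne assms(2)[of i] by (auto simp: norm_sgn)
  show ?thesis
    unfolding assms(6-8) cos_angle_at
    using inner_of_unit_triple[OF bal unit unit unit w w]
      inner_of_unit_triple[OF bal2 unit unit unit w w]
      inner_of_unit_triple[OF bal3 unit unit unit w w]
    by blast
qed

end
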